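(* Let $U_1, U_2, \dots$ be a sequence of i.i.d. random variables uniformly distributed on $(0,1)$. For $n \ge 1$ let $\alpha_n$ be the continuous version of the uniform empirical process of $U_1,\dots,U_n$, and let $\{\alpha^n_{jk}\}_{j,k}$ be its coefficient sequence (both as defined in the context). Then for every $n \ge 1$, almost surely, $$\{\alpha^n_{jk}\}_{j,k} \in S_{2,\infty}^{1/2} \quad\text{and}\quad \{\alpha^n_{jk}\}_{j,k} \notin S_{2,\infty}^{1/2,0}.$$
   Context: **Empirical distribution function.** For $n\ge 1$ and $0\le s\le 1$, $\widetilde F_n(s) = \frac1n\sum_{i=1}^n 1_{(-\infty,s]}(U_i)$. Let $U_1^{(n)} \le U_2^{(n)}\le \dots \le U_n^{(n)}$ be the order statistics of $U_1,\dots,U_n$ (almost surely distinct and in $(0,1)$), with the conventions $U_0^{(n)}=0$ and $U_{n+1}^{(n)}=1$. **Continuous version.** The continuous function $F_n$ on $[0,1]$ is defined, for $0\le k\le n-1$, by $$F_n(s) = \widetilde F_n(U_k^{(n)}) + 2\left(s - \frac{U_k^{(n)}+U_{k+1}^{(n)}}{2}\right)\left(\frac{\widetilde F_n(U_{k+1}^{(n)}) - \widetilde F_n(U_k^{(n)})}{U_{k+2}^{(n)} - U_k^{(n)}}\right) \quad\text{if}\quad \frac{U_k^{(n)}+U_{k+1}^{(n)}}{2} \le s \le \frac{U_{k+1}^{(n)}+U_{k+2}^{(n)}}{2},$$ together with $F_n(s)=0$ for $0\le s\le U_1^{(n)}/2$ and $F_n(s)=1$ for $(U_n^{(n)}+1)/2\le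 s\le 1$. The continuous version of the empirical process is $\alpha_n(s) = \sqrt n\,(F_n(s)-s)$, $0\le s\le 1$. **Coefficients.** For $j\ge 0$ and $k=1,\dots,2^j$, $$\alpha_{jk}^n = 2^{j/2}\left[2\,\alpha_n\!\left(\frac{k-1/2}{2^j}\right) - \alpha_n\!\left(\frac{k-1}{2^j}\right) - \alpha_n\!\left(\frac{k}{2^j}\right)\right].$$ The two initial coefficients of the sequence are $\alpha_n(0)$ (in the role of $\mu_0$ below) and $\alpha_n(1)-\alpha_n(0)$ (in the role of $\mu_1$ below). **Sequence spaces.** For $1\le p<\infty$ and real $\alpha$, $S_{p,\infty}^{\alpha}$ is the space of real sequences $\mu = (\mu_{jk},\ j\ge 0,\ k=1,\dots,2^j)$, with two initial coefficients $\mu_0,\mu_1$, such that $\|\mu\|_{p,\infty}^{\alpha}<\infty$, where $$\|\mu\|_{p,\infty}^{\alpha} = \sup\left\{|\mu_0|,\ |\mu_1|,\ \sup_{j\ge 0} 2^{-j(1/2-\alpha-1/p)}\left(\sum_{k=1}^{2^j}|\mu_{jk}|^p\right)^{1/p}\right\}.$$ The subspace $S_{p,\infty}^{\alpha,0}$ consists of those $\mu\in S_{p,\infty}^{\alpha}$ such that $2^{-j(1/2-\alpha-1/p)}\left(\sum_{k=1}^{2^j}|\mu_{jk}|^p\right)^{1/p}\to 0$ as $j\to\infty$. *)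

theory Defs
  imports "HOL-Probability.Probability"
begin

section \<open>The continuous version of the uniform empirical process\<close>

text \<open>
  A sample is a sequence \<^term>\<open>u :: nat \<Rightarrow> real\<close>; the sample of size \<open>n\<close> consists of
  \<open>u 1, \<dots>, u n\<close>, and \<open>u 0\<close> is never used.
\<close>

definition emp_cdf :: "(nat \<Rightarrow> real) \<Rightarrow> nat \<Rightarrow> real \<Rightarrow> real" where
  "emp_cdf u n s = (1 / real n) * (\<Sum>i = 1..n. indicator {..s} (u i))"

definition order_stat :: "(nat \<Rightarrow> real) \<Rightarrow> nat \<Rightarrow> nat \<Rightarrow> real" where
  "order_stat u n k =
     (if k = 0 then 0 else if k > n then 1 else sort (map u [1..<Suc n]) ! (k - 1))"

definition order_mid :: "(nat \<Rightarrow> real) \<Rightarrow> nat \<Rightarrow> nat \<Rightarrow> real" where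
  "order_mid u n k = (order_stat u n k + order_stat u n (Suc k)) / 2"

definition cont_piece :: "(nat \<Rightarrow> real) \<Rightarrow> nat \<Rightarrow> nat \<Rightarrow> real \<Rightarrow> real" where
  "cont_piece u n k s =
     emp_cdf u n (order_stat u n k)
     + 2 * (s - (order_stat u n k + order_stat u n (k + 1)) / 2)
         * ((emp_cdf u n (order_stat u n (k + 1)) - emp_cdf u n (order_stat u n k))
            / (order_stat u n (k + 2) - order_stat u n k))"

text \<open>
  The pieces are given on closed intervals that share endpoints. To get a total function, the
  piece of least index is used; the lemmas \<open>cont_emp_cdf_piece\<close>, \<open>cont_emp_cdf_left\<close> and
  \<open>cont_emp_cdf_right\<close> below show that, for distinct sample points in the open unit interval
  (an almost sure event for the uniform law), all the defining clauses hold on the whole of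
  their closed intervals, so that this choice is immaterial.
\<close>

definition cont_emp_cdf :: "(nat \<Rightarrow> real) \<Rightarrow> nat \<Rightarrow> real \<Rightarrow> real" where
  "cont_emp_cdf u n s =
     (if s \<le> order_stat u n 1 / 2 then 0
      else if (order_stat u n n + 1) / 2 \<le> s then 1
      else cont_piece u n (LEAST k. k < n \<and> order_mid u n k \<le> s \<and> s \<le> order_mid u n (k + 1)) s)"

definition cont_emp_process :: "(nat \<Rightarrow> real) \<Rightarrow> nat \<Rightarrow> real \<Rightarrow> real" where
  "cont_emp_process u n s = sqrt (real n) * (cont_emp_cdf u n s - s)"


section \<open>Sequence spaces\<close>

text \<open>
  The entry \<open>coef j k\<close> is meaningful for \<open>k\<close> in \<open>{1..2^j}\<close> only; no definition below inspects
  the others. The smoothness index is called \<open>a\<close>.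
\<close>

record coeff_seq =
  init0 :: real
  init1 :: real
  coef :: "nat \<Rightarrow> nat \<Rightarrow> real"

definition level_norm :: "real \<Rightarrow> real \<Rightarrow> coeff_seq \<Rightarrow> nat \<Rightarrow> real" where
  "level_norm p a \<mu> j =
     2 powr (- real j * (1 / 2 - a - 1 / p))
     * (\<Sum>k = 1..2 ^ j. \<bar>coef \<mu> j k\<bar> powr p) powr (1 / p)"

definition seq_norm :: "real \<Rightarrow> real \<Rightarrow> coeff_seq \<Rightarrow> ereal" where
  "seq_norm p a \<mu> =
     Sup ({ereal \<bar>init0 \<mu>\<bar>, ereal \<bar>init1 \<mu>\<bar>} \<union> range (\<lambda>j. ereal (level_norm p a \<mu> j)))"

definition S_space :: "real \<Rightarrow> real \<Rightarrow> coeff_seq set" where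
  "S_space p a = {\<mu>. seq_norm p a \<mu> < \<infinity>}"

definition S_space0 :: "real \<Rightarrow> real \<Rightarrow> coeff_seq set" where
  "S_space0 p a = {\<mu> \<in> S_space p a. level_norm p a \<mu> \<longlonglongrightarrow> 0}"

definition schauder_coeffs :: "(real \<Rightarrow> real) \<Rightarrow> coeff_seq" where
  "schauder_coeffs f =
     \<lparr>init0 = f 0,
      init1 = f 1 - f 0,
      coef = (\<lambda>j k. 2 powr (real j / 2)
                * (2 * f ((real k - 1 / 2) / 2 ^ j) - f ((real k - 1) / 2 ^ j) - f (real k / 2 ^ j)))\<rparr>"


section \<open>Consistency of the piecewise definition\<close>

context
  fixes u :: "nat \<Rightarrow> real" and n :: nat
  assumes n: "n \<ge> 1"
    and inj: "inj_on u {1..n}"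
    and range01: "\<And>i. i \<in> {1..n} \<Longrightarrow> 0 < u i \<and> u i < 1"
begin

lemma order_stat_mem:
  assumes "1 \<le> k" "k \<le> n"
  shows "order_stat u n k \<in> u ` {1..n}"
proof -
  have "sort (map u [1..<Suc n]) ! (k - 1) \<in> set (sort (map u [1..<Suc n]))"
    by (rule nth_mem) (use assms in simp)
  also have "\<dots> = u ` {1..n}" by (simp add: atLeastLessThanSuc_atLeastAtMost del: upt_Suc)
  finally show ?thesis using assms by (simp add: order_stat_def del: upt_Suc)
qed

lemma order_stat_less_Suc:
  assumes "k \<le> n"
  shows "order_stat u n k < order_stat u n (Suc k)"
proof -
  consider "k = 0" | "k = n" "k \<noteq> 0" | "1 \<le> k" "k < n" using assms by linarith
  then show ?thesis
  proof cases
    case 1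
    then show ?thesis using order_stat_mem[of 1] range01 n by (auto simp: order_stat_def[of _ _ 0])
  next
    case 2
    then show ?thesis using order_stat_mem[of n] range01 n
      by (auto simp: order_stat_def[of _ _ "Suc n"])
  next
    case 3
    have "distinct (map u [1..<Suc n])"
      using inj by (simp add: distinct_map atLeastLessThanSuc_atLeastAtMost del: upt_Suc)
    then have "sorted_wrt (<) (sort (map u [1..<Suc n]))"
      by (simp add: strict_sorted_iff del: upt_Suc)
    from sorted_wrt_nth_less[OF this, of "k - 1" k] show ?thesis
      using 3 by (simp add: order_stat_def del: upt_Suc)
  qed
qed

lemma order_stat_mono: "k \<le> l \<Longrightarrow> l \<le> Suc n \<Longrightarrow> order_stat u n k \<le> order_stat u n l"
  by (induction l rule: dec_induct) (auto intro: order.trans less_imp_le[OF order_stat_less_Suc])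

lemma order_mid_less_Suc: "k < n \<Longrightarrow> order_mid u n k < order_mid u n (Suc k)"
  using order_stat_less_Suc[of k] order_stat_less_Suc[of "Suc k"] by (simp add: order_mid_def)

lemma order_mid_mono: "k \<le> l \<Longrightarrow> l \<le> n \<Longrightarrow> order_mid u n k \<le> order_mid u n l"
proof (induction l rule: dec_induct)
  case (step m)
  then show ?case using order_mid_less_Suc[of m] by simp
qed simp

lemma emp_cdf_0: "emp_cdf u n 0 = 0"
  using range01 by (force simp: emp_cdf_def indicator_def intro!: sum.neutral)

lemma emp_cdf_last: "emp_cdf u n (order_stat u n n) = 1"
proof -
  have "u i \<le> order_stat u n n" if "i \<in> {1..n}" for i
  proof -
    have "u i \<in> set (sort (map u [1..<Suc n]))"
      using that by (simp add: atLeastLessThanSuc_atLeastAtMost del: upt_Suc)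
    then have "\<exists>m < length (sort (map u [1..<Suc n])). sort (map u [1..<Suc n]) ! m = u i"
      unfolding in_set_conv_nth .
    then obtain m where m: "m < n" "u i = sort (map u [1..<Suc n]) ! m"
      by (auto simp del: upt_Suc)
    then have "u i = order_stat u n (Suc m)" by (simp add: order_stat_def del: upt_Suc)
    then show ?thesis using order_stat_mono[of "Suc m" n] m by simp
  qed
  then show ?thesis using n by (simp add: emp_cdf_def indicator_def)
qed

lemma cont_piece_left: "cont_piece u n k (order_mid u n k) = emp_cdf u n (order_stat u n k)"
  by (simp add: cont_piece_def order_mid_def)

lemma cont_piece_right:
  assumes "k < n"
  shows "cont_piece u n k (order_mid u n (Suc k)) = emp_cdf u n (order_stat u n (Suc k))"
proof -
  have "order_stat u n k < order_stat u n (Suc (Suc k))"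
    using order_stat_less_Suc[of k] order_stat_less_Suc[of "Suc k"] assms by simp
  then show ?thesis by (simp add: cont_piece_def order_mid_def field_simps)
qed

lemma cont_emp_cdf_left: "s \<le> order_stat u n 1 / 2 \<Longrightarrow> cont_emp_cdf u n s = 0"
  by (simp add: cont_emp_cdf_def)

lemma cont_emp_cdf_right:
  assumes "(order_stat u n n + 1) / 2 \<le> s"
  shows "cont_emp_cdf u n s = 1"
proof -
  have "order_stat u n 1 \<le> order_stat u n n" by (rule order_stat_mono) (use n in auto)
  then have "order_stat u n 1 / 2 < (order_stat u n n + 1) / 2" by simp
  then have "\<not> s \<le> order_stat u n 1 / 2" using assms by simp
  then show ?thesis using assms by (simp add: cont_emp_cdf_def)
qed

lemma cont_emp_cdf_piece:
  assumes k: "k < n" and s: "order_mid u n k \<le> s" "s \<le> order_mid u n (k + 1)"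
  shows "cont_emp_cdf u n s = cont_piece u n k s"
proof -
  have m0: "order_mid u n 0 = order_stat u n 1 / 2"
    by (simp add: order_mid_def order_stat_def)
  have mn: "order_mid u n n = (order_stat u n n + 1) / 2"
    by (simp add: order_mid_def order_stat_def[of _ _ "Suc n"])
  consider "s \<le> order_mid u n 0" | "order_mid u n n \<le> s"
    | "order_mid u n 0 < s" "s < order_mid u n n" by linarith
  then show ?thesis
  proof cases
    case 1
    then have "order_mid u n k \<le> order_mid u n 0" using s by simp
    moreover have "order_mid u n 0 < order_mid u n k" if "k \<noteq> 0"
      using order_mid_less_Suc[of 0] order_mid_mono[of 1 k] that k by simp
    ultimately have "k = 0" by force
    with 1 s have s0: "s = order_mid u n 0" by simp
    have "cont_piece u n 0 s = 0"
      unfolding s0 cont_piece_left using emp_cdf_0 by (simp add: order_stat_def)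
    moreover have "cont_emp_cdf u n s = 0"
      using s0 unfolding m0 by (intro cont_emp_cdf_left) simp
    ultimately show ?thesis using \<open>k = 0\<close> by simp
  next
    case 2
    then have "order_mid u n n \<le> order_mid u n (Suc k)" using s by simp
    moreover have "order_mid u n (Suc k) < order_mid u n n" if "Suc k \<noteq> n"
      using order_mid_less_Suc[of "Suc k"] order_mid_mono[of "Suc (Suc k)" n] that k by simp
    ultimately have "Suc k = n" by force
    with 2 s have sn: "s = order_mid u n n" by simp
    have "cont_piece u n k s = 1"
      using cont_piece_right[OF k] emp_cdf_last unfolding sn \<open>Suc k = n\<close> by simp
    moreover have "cont_emp_cdf u n s = 1"
      using sn unfolding mn by (intro cont_emp_cdf_right) simp
    ultimately show ?thesis by simp
  next
    case 3
    let ?P = "\<lambda>k. k < n \<and> order_mid u n k \<le> s \<and> s \<le> order_mid u n (k + 1)"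
    define l where "l = (LEAST k. ?P k)"
    have P: "?P k" using k s by simp
    have l: "?P l" unfolding l_def by (rule LeastI[of ?P, OF P])
    have "l \<le> k" unfolding l_def by (rule Least_le[of ?P, OF P])
    have F: "cont_emp_cdf u n s = cont_piece u n l s"
      using 3 by (simp add: cont_emp_cdf_def l_def m0 mn)
    show ?thesis
    proof (cases "l = k")
      case False
      then have lk: "Suc l \<le> k" using \<open>l \<le> k\<close> by simp
      then have "order_mid u n (Suc l) \<le> order_mid u n k" using order_mid_mono k by simp
      with l s have eq: "s = order_mid u n (Suc l)" "s = order_mid u n k" by simp_all
      have "Suc l = k"
      proof (rule ccontr)
        assume "Suc l \<noteq> k"
        then have "order_mid u n (Suc l) < order_mid u n k"
          using order_mid_less_Suc[of "Suc l"] order_mid_mono[of "Suc (Suc l)" k] lk k by simp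
        with eq show False by simp
      qed
      then show ?thesis
        using F eq cont_piece_right[of l] cont_piece_left[of k] l by simp
    qed (use F in simp)
  qed
qed

end

end

theory Submission
  imports Defs
begin

text \<open>
  For \<open>p = 2\<close> and smoothness \<open>1/2\<close>, the level-\<open>j\<close> norm of the coefficients of \<open>f\<close> is the square
  root of \<open>4^j\<close> times the sum of the squared second differences of \<open>f\<close> over the dyadic intervals
  of length \<open>2^-j\<close>. A second difference does not see affine functions, and the path of the
  process is piecewise affine, so only the dyadic intervals with a kink in their interior
  contribute.

  Membership: at each level a single hinge \<open>\<lambda>s. max 0 (s - t)\<close> has at most one non-zero second
  difference, and its size is at most \<open>2^-j\<close>; hence its level norms are bounded
  (\<open>bdd_level_energy_hinge\<close>). The continuous distribution function is a finite linear combination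
  of hinges (\<open>cont_emp_cdf_hinges\<close>), and boundedness of the level norms is preserved under linear
  combinations.

  Non-membership in the small space: let \<open>t\<close> be the first kink, which is half of the smallest
  observation, and let \<open>c \<noteq> 0\<close> be the jump of the slope there. At a fine level the dyadic interval
  around \<open>t\<close> contains no other kink, and its second difference is exactly \<open>- c / 2^j\<close> times the
  distance from \<open>2^j * t\<close> to the integers. So the level norms could tend to zero only if that
  distance did. But a distance below \<open>1/4\<close> doubles from one level to the next, hence it cannot
  stay below \<open>1/4\<close> unless it is zero, that is, unless \<open>t\<close> is dyadic
  (\<open>int_dist_dyadic_not_tendsto_0\<close>).

  Both arguments hold for every sample of distinct irrational points of the open unit interval,
  and by independence and absence of atoms almost every sample is of this kind.
\<close>

section \<open>Second differences and level norms\<close>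

definition second_diff :: "(real \<Rightarrow> real) \<Rightarrow> real \<Rightarrow> real \<Rightarrow> real" where
  "second_diff f l r = 2 * f ((l + r) / 2) - f l - f r"

definition level_energy :: "(real \<Rightarrow> real) \<Rightarrow> nat \<Rightarrow> real" where
  "level_energy f j = 4 ^ j * (\<Sum>k = 1..2 ^ j. (second_diff f ((real k - 1) / 2 ^ j) (real k / 2 ^ j))\<^sup>2)"

abbreviation hinge :: "real \<Rightarrow> real \<Rightarrow> real" where
  "hinge t s \<equiv> max 0 (s - t)"

text \<open>
  The coefficients carry a factor \<open>2 powr (j / 2)\<close> and the level norm another one; squaring gives
  the \<open>4 ^ j\<close> of \<^const>\<open>level_energy\<close>.
\<close>

lemma level_norm_schauder_coeffs:
  "level_norm 2 (1 / 2) (schauder_coeffs f) j = sqrt (level_energy f j)"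
proof -
  define d where "d k = second_diff f ((real k - 1) / 2 ^ j) (real k / 2 ^ j)" for k
  have mid: "((real k - 1) / 2 ^ j + real k / 2 ^ j) / 2 = (real k - 1 / 2) / 2 ^ j" for k
    by (simp add: field_simps)
  have h: "(2::real) powr (real j / 2) = sqrt (2 ^ j)"
    by (simp add: powr_half_sqrt[symmetric] powr_powr powr_realpow[symmetric])
  have coef: "coef (schauder_coeffs f) j k = sqrt (2 ^ j) * d k" for k
    by (simp only: schauder_coeffs_def h d_def second_diff_def mid coeff_seq.simps)
  have sum: "(\<Sum>k = 1..2 ^ j. \<bar>coef (schauder_coeffs f) j k\<bar> powr 2)
      = 2 ^ j * (\<Sum>k = 1..2 ^ j. (d k)\<^sup>2)"
    by (simp add: coef power_mult_distrib sum_distrib_left)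
  have nn: "0 \<le> (2::real) ^ j * (\<Sum>k = 1..2 ^ j. (d k)\<^sup>2)"
    by (intro mult_nonneg_nonneg sum_nonneg) auto
  have "level_norm 2 (1 / 2) (schauder_coeffs f) j
      = 2 powr (real j / 2) * (2 ^ j * (\<Sum>k = 1..2 ^ j. (d k)\<^sup>2)) powr (1 / 2)"
    unfolding level_norm_def sum by simp
  also have "\<dots> = sqrt (2 ^ j) * sqrt (2 ^ j * (\<Sum>k = 1..2 ^ j. (d k)\<^sup>2))"
    using nn by (simp add: h powr_half_sqrt)
  also have "\<dots> = sqrt (2 ^ j * (2 ^ j * (\<Sum>k = 1..2 ^ j. (d k)\<^sup>2)))"
    by (simp add: real_sqrt_mult)
  also have "2 ^ j * (2 ^ j * (\<Sum>k = 1..2 ^ j. (d k)\<^sup>2)) = level_energy f j"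
    by (simp add: level_energy_def d_def power_mult_distrib[symmetric] mult.assoc[symmetric])
  finally show ?thesis .
qed

lemma level_energy_nonneg: "0 \<le> level_energy f j"
  unfolding level_energy_def by (intro mult_nonneg_nonneg sum_nonneg) auto

lemma schauder_coeffs_in_S_spaceI:
  assumes "bdd_above (range (level_energy f))"
  shows "schauder_coeffs f \<in> S_space 2 (1 / 2)"
proof -
  obtain C where C: "level_energy f j \<le> C" for j using assms by (auto simp: bdd_above_def)
  define K where "K = max (sqrt C) (max \<bar>f 0\<bar> \<bar>f 1 - f 0\<bar>)"
  have "seq_norm 2 (1 / 2) (schauder_coeffs f) \<le> ereal K"
    unfolding seq_norm_def level_norm_schauder_coeffs using C
    by (intro Sup_least) (auto simp: schauder_coeffs_def le_max_iff_disj K_def)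
  also have "\<dots> < \<infinity>" by simp
  finally show ?thesis by (simp add: S_space_def)
qed

section \<open>Combinations of hinges have bounded level norms\<close>

lemma bdd_level_energy_add:
  assumes "bdd_above (range (level_energy f))" "bdd_above (range (level_energy g))"
  shows "bdd_above (range (level_energy (\<lambda>s. f s + g s)))"
proof -
  have sq: "(x + y)\<^sup>2 \<le> 2 * x\<^sup>2 + 2 * y\<^sup>2" for x y :: real
    using zero_le_power2[of "x - y"] by (simp add: power2_eq_square algebra_simps)
  have le: "level_energy (\<lambda>s. f s + g s) j \<le> 2 * level_energy f j + 2 * level_energy g j" for j
  proof -
    have "second_diff (\<lambda>s. f s + g s) l r = second_diff f l r + second_diff g l r" for l r
      by (simp add: second_diff_def)
    then have "level_energy (\<lambda>s. f s + g s) j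
        \<le> 4 ^ j * (\<Sum>k = 1..2 ^ j. 2 * (second_diff f ((real k - 1) / 2 ^ j) (real k / 2 ^ j))\<^sup>2
                       + 2 * (second_diff g ((real k - 1) / 2 ^ j) (real k / 2 ^ j))\<^sup>2)"
      unfolding level_energy_def by (auto intro!: mult_left_mono sum_mono sq)
    also have "\<dots> = 2 * level_energy f j + 2 * level_energy g j"
      unfolding level_energy_def by (simp add: sum.distrib sum_distrib_left[symmetric] algebra_simps)
    finally show ?thesis .
  qed
  obtain C D where "level_energy f j \<le> C" "level_energy g j \<le> D" for j
    using assms by (auto simp: bdd_above_def)
  then have "level_energy (\<lambda>s. f s + g s) j \<le> 2 * C + 2 * D" for j
    using le[of j] by (smt (verit))
  then show ?thesis by (auto simp: bdd_above_def)
qed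

lemma bdd_level_energy_cmult:
  assumes "bdd_above (range (level_energy f))"
  shows "bdd_above (range (level_energy (\<lambda>s. c * f s)))"
proof -
  have "second_diff (\<lambda>s. c * f s) l r = c * second_diff f l r" for l r
    by (simp add: second_diff_def algebra_simps)
  then have eq: "level_energy (\<lambda>s. c * f s) j = c\<^sup>2 * level_energy f j" for j
    by (simp add: level_energy_def power_mult_distrib sum_distrib_left mult.left_commute)
  obtain C where "level_energy f j \<le> C" for j using assms by (auto simp: bdd_above_def)
  then have "level_energy (\<lambda>s. c * f s) j \<le> c\<^sup>2 * C" for j
    unfolding eq by (intro mult_left_mono) auto
  then show ?thesis by (auto simp: bdd_above_def)
qed

lemma bdd_level_energy_affine: "bdd_above (range (level_energy (\<lambda>s. a * s + b)))"
proof -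
  have "second_diff (\<lambda>s. a * s + b) l r = 0" for l r
    by (simp add: second_diff_def field_simps)
  then have "level_energy (\<lambda>s. a * s + b) j = 0" for j by (simp add: level_energy_def)
  then show ?thesis by simp
qed

lemma bdd_level_energy_sum:
  assumes "\<And>i. i \<in> A \<Longrightarrow> bdd_above (range (level_energy (f i)))"
  shows "bdd_above (range (level_energy (\<lambda>s. \<Sum>i\<in>A. f i s)))"
  using assms
proof (induction A rule: infinite_finite_induct)
  case (insert i A)
  then show ?case using bdd_level_energy_add[of "f i" "\<lambda>s. \<Sum>i\<in>A. f i s"] by simp
qed (use bdd_level_energy_affine[of 0 0] in simp_all)

lemma second_diff_hinge:
  assumes "l \<le> r"
  shows "second_diff (hinge t) l r = - max 0 (min (t - l) (r - t))"
  using assms by (simp add: second_diff_def max_def min_def field_simps)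

text \<open>
  Only the dyadic interval with \<open>t\<close> in its interior sees the kink at \<open>t\<close>; its index is
  \<open>\<lceil>2 ^ j * t\<rceil>\<close>.
\<close>

lemma bdd_level_energy_hinge: "bdd_above (range (level_energy (hinge t)))"
proof -
  have "level_energy (hinge t) j \<le> 1" for j
  proof -
    let ?N = "(2::real) ^ j"
    have term_le: "(second_diff (hinge t) ((real k - 1) / ?N) (real k / ?N))\<^sup>2
        \<le> (if k = nat \<lceil>?N * t\<rceil> then (1 / ?N)\<^sup>2 else 0)" for k
    proof -
      let ?l = "(real k - 1) / ?N" and ?r = "real k / ?N"
      have lr: "?r - ?l = 1 / ?N" by (simp add: field_simps)
      have le: "?l \<le> ?r" by (simp add: divide_right_mono)
      show ?thesis
      proof (cases "?l < t \<and> t < ?r")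
        case True
        then have "real k - 1 < ?N * t" "?N * t < real k" by (simp_all add: field_simps)
        then have "\<lceil>?N * t\<rceil> = int k" by (intro ceiling_unique) auto
        moreover have "\<bar>second_diff (hinge t) ?l ?r\<bar> \<le> 1 / ?N"
          unfolding second_diff_hinge[OF le] using lr True by auto
        then have "(second_diff (hinge t) ?l ?r)\<^sup>2 \<le> (1 / ?N)\<^sup>2"
          by (metis abs_ge_zero power2_abs power_mono)
        ultimately show ?thesis by simp
      next
        case False
        then have "second_diff (hinge t) ?l ?r = 0" unfolding second_diff_hinge[OF le] by auto
        then show ?thesis by simp
      qed
    qed
    have "level_energy (hinge t) j
        \<le> 4 ^ j * (\<Sum>k = 1..2 ^ j. if k = nat \<lceil>?N * t\<rceil> then (1 / ?N)\<^sup>2 else 0)"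
      unfolding level_energy_def by (intro mult_left_mono sum_mono term_le) simp
    also have "\<dots> \<le> 4 ^ j * (1 / ?N)\<^sup>2" by (intro mult_left_mono) auto
    also have "\<dots> = 1" by (simp add: power_divide power_mult[symmetric] mult.commute[of j] power_mult)
    finally show ?thesis .
  qed
  then show ?thesis by (auto simp: bdd_above_def)
qed

section \<open>An isolated non-dyadic kink\<close>

text \<open>The distance to the nearest integer.\<close>

definition int_dist :: "real \<Rightarrow> real" where
  "int_dist x = min (frac x) (1 - frac x)"

lemma int_dist_double:
  assumes "int_dist x < 1 / 4"
  shows "int_dist (2 * x) = 2 * int_dist x"
proof -
  have f: "0 \<le> frac x" "frac x < 1" "x = of_int \<lfloor>x\<rfloor> + frac x"
    by (auto simp: frac_lt_1) (simp add: frac_def)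
  consider "frac x < 1 / 4" | "3 / 4 < frac x" using assms by (auto simp: int_dist_def min_def split: if_splits)
  then show ?thesis
  proof cases
    case 1
    have "\<lfloor>2 * x\<rfloor> = 2 * \<lfloor>x\<rfloor>" by (rule floor_unique) (use 1 f in auto)
    then have "frac (2 * x) = 2 * frac x" by (simp add: frac_def)
    then show ?thesis using 1 by (simp add: int_dist_def)
  next
    case 2
    have "\<lfloor>2 * x\<rfloor> = 2 * \<lfloor>x\<rfloor> + 1" by (rule floor_unique) (use 2 f in auto)
    then have "frac (2 * x) = 2 * frac x - 1" by (simp add: frac_def)
    then show ?thesis using 2 by (simp add: int_dist_def)
  qed
qed

text \<open>
  A sequence that doubles whenever it is below \<open>1/4\<close> cannot converge to zero through positive values.
\<close>

lemma int_dist_dyadic_not_tendsto_0: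
  assumes t: "\<And>j. 2 ^ j * t \<notin> \<int>"
  shows "\<not> (\<lambda>j. int_dist (2 ^ j * t)) \<longlonglongrightarrow> 0"
proof
  assume "(\<lambda>j. int_dist (2 ^ j * t)) \<longlonglongrightarrow> 0"
  then have "eventually (\<lambda>j. int_dist (2 ^ j * t) < 1 / 4) sequentially"
    by (rule order_tendstoD) simp
  then obtain N where N: "int_dist (2 ^ j * t) < 1 / 4" if "j \<ge> N" for j
    by (auto simp: eventually_sequentially)
  have pow: "int_dist (2 ^ (N + i) * t) = 2 ^ i * int_dist (2 ^ N * t)" for i
  proof (induction i)
    case (Suc i)
    then show ?case using int_dist_double[OF N[of "N + i"]] by (simp add: mult.assoc)
  qed simp
  have "0 < int_dist (2 ^ N * t)"
    using t[of N] frac_gt_0_iff[of "2 ^ N * t"] frac_lt_1[of "2 ^ N * t"] by (simp add: int_dist_def)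
  then obtain i where "1 / int_dist (2 ^ N * t) < 2 ^ i" using real_arch_pow[of 2] by auto
  then have "1 < 2 ^ i * int_dist (2 ^ N * t)"
    using \<open>0 < int_dist (2 ^ N * t)\<close> by (simp add: field_simps)
  then show False using N[of "N + i"] pow[of i] by simp
qed

text \<open>
  The interval of level \<open>j\<close> around the kink is \<open>[\<lfloor>x\<rfloor> / 2 ^ j, (\<lfloor>x\<rfloor> + 1) / 2 ^ j]\<close> with \<open>x = 2 ^ j * t\<close>.
  Once it is shorter than \<open>b - t\<close>, it lies in \<open>[0, b]\<close>, where \<open>f\<close> is a multiple of a hinge plus an
  affine function, so this one summand already gives the bound.
\<close>

lemma level_energy_ge_at_kink:
  assumes t: "0 < t" and b: "b \<le> 1"
    and f: "\<And>s. 0 \<le> s \<Longrightarrow> s \<le> b \<Longrightarrow> f s = c * hinge t s + (p * s + q)"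
    and j: "1 / 2 ^ j < b - t"
  shows "(c * int_dist (2 ^ j * t))\<^sup>2 \<le> level_energy f j"
proof -
  let ?N = "(2::real) ^ j"
  define x where "x = ?N * t"
  define k where "k = Suc (nat \<lfloor>x\<rfloor>)"
  have x: "x \<ge> 0" "t = x / ?N" using t by (simp_all add: x_def)
  have fl: "of_int \<lfloor>x\<rfloor> = real k - 1" using x by (simp add: k_def)
  define l r where "l = (real k - 1) / ?N" and "r = real k / ?N"
  have tl: "t - l = frac x / ?N" by (simp add: l_def x(2) frac_def fl diff_divide_distrib)
  have rt: "r - t = (1 - frac x) / ?N" by (simp add: r_def x(2) frac_def fl diff_divide_distrib)
  have "l \<le> t" using tl by (metis diff_ge_0_iff_ge divide_nonneg_nonneg frac_ge_0 zero_le_numeral zero_le_power)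
  have "t \<le> r" using rt frac_lt_1[of x]
    by (metis diff_ge_0_iff_ge divide_nonneg_nonneg less_imp_le zero_le_numeral zero_le_power)
  have "0 \<le> l" by (simp add: l_def k_def)
  have "r - t \<le> 1 / ?N" unfolding rt by (intro divide_right_mono) auto
  then have "r < b" using j by simp
  then have "real k < b * ?N" by (simp add: r_def field_simps)
  also have "\<dots> \<le> ?N" using b by simp
  finally have "real k < real (2 ^ j)" by simp
  then have "k < 2 ^ j" by (rule of_nat_less_imp_less)
  then have k: "k \<in> {1..2 ^ j}" by (simp add: k_def)
  have "second_diff f l r = c * second_diff (hinge t) l r"
    using \<open>0 \<le> l\<close> \<open>l \<le> t\<close> \<open>t \<le> r\<close> \<open>r < b\<close>
    unfolding second_diff_def by (subst (1 2 3) f) (auto simp: field_simps)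
  also have "second_diff (hinge t) l r = - (int_dist x / ?N)"
  proof -
    have "min (frac x / ?N) ((1 - frac x) / ?N) = int_dist x / ?N"
      by (auto simp: int_dist_def min_def divide_le_cancel)
    moreover have "0 \<le> int_dist x / ?N" using frac_lt_1[of x] by (simp add: int_dist_def less_imp_le)
    ultimately show ?thesis
      using \<open>l \<le> t\<close> \<open>t \<le> r\<close> by (subst second_diff_hinge) (auto simp: tl rt)
  qed
  finally have "(c * int_dist x)\<^sup>2 = 4 ^ j * (second_diff f l r)\<^sup>2"
    by (simp add: power_mult_distrib power_divide power_mult[symmetric] mult.commute[of j] power_mult)
  also have "\<dots> \<le> level_energy f j"
    unfolding level_energy_def l_def r_def using k
    by (intro mult_left_mono member_le_sum[where f = "\<lambda>k. (second_diff f ((real k - 1) / ?N) (real k / ?N))\<^sup>2"]) auto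
  finally show ?thesis by (simp add: x_def)
qed

lemma level_energy_not_tendsto_0:
  assumes t: "0 < t" "t < b" "b \<le> 1" and c: "c \<noteq> 0" and nd: "\<And>j. 2 ^ j * t \<notin> \<int>"
    and f: "\<And>s. 0 \<le> s \<Longrightarrow> s \<le> b \<Longrightarrow> f s = c * hinge t s + (p * s + q)"
  shows "\<not> level_energy f \<longlonglongrightarrow> 0"
proof
  assume E: "level_energy f \<longlonglongrightarrow> 0"
  have "(\<lambda>j. (1 / 2 :: real) ^ j) \<longlonglongrightarrow> 0" by (rule LIMSEQ_power_zero) simp
  then have ev: "eventually (\<lambda>j. 1 / 2 ^ j < b - t) sequentially"
    using order_tendstoD(2)[of _ 0 _ "b - t"] t by (simp add: power_one_over)
  have "(\<lambda>j. (c * int_dist (2 ^ j * t))\<^sup>2) \<longlonglongrightarrow> 0"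
  proof (rule tendsto_sandwich[OF _ _ tendsto_const E])
    show "eventually (\<lambda>j. (c * int_dist (2 ^ j * t))\<^sup>2 \<le> level_energy f j) sequentially"
      using ev by eventually_elim (rule level_energy_ge_at_kink[OF t(1,3) f])
  qed simp
  from tendsto_real_sqrt[OF this] have "(\<lambda>j. c * int_dist (2 ^ j * t)) \<longlonglongrightarrow> 0"
    by (simp add: tendsto_rabs_zero_iff flip: abs_mult)
  then have "(\<lambda>j. inverse c * (c * int_dist (2 ^ j * t))) \<longlonglongrightarrow> 0" by (rule tendsto_mult_right_zero)
  then have "(\<lambda>j. int_dist (2 ^ j * t)) \<longlonglongrightarrow> 0" using c by (simp add: field_simps)
  with int_dist_dyadic_not_tendsto_0[OF nd] show False by blast
qed

section \<open>Linear interpolation as a combination of hinges\<close>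

text \<open>The continuous function that is 0 up to \<open>a\<close>, 1 from \<open>b\<close> on, and affine in between.\<close>

definition ramp :: "real \<Rightarrow> real \<Rightarrow> real \<Rightarrow> real" where
  "ramp a b s = (hinge a s - hinge b s) / (b - a)"

lemma ramp_left: "a < b \<Longrightarrow> s \<le> a \<Longrightarrow> ramp a b s = 0"
  and ramp_mid: "a < b \<Longrightarrow> a \<le> s \<Longrightarrow> s \<le> b \<Longrightarrow> ramp a b s = (s - a) / (b - a)"
  and ramp_right: "a < b \<Longrightarrow> b \<le> s \<Longrightarrow> ramp a b s = 1"
  by (simp_all add: ramp_def)

text \<open>To the left of \<open>s\<close> the ramps are complete, so their increments telescope.\<close>

lemma sum_ramps:
  fixes m y :: "nat \<Rightarrow> real"
  assumes m: "\<And>k. k < n \<Longrightarrow> m k < m (Suc k)"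
    and k: "k \<le> n" "\<And>i. i < k \<Longrightarrow> m (Suc i) \<le> s"
    and right: "\<And>i. Suc k \<le> i \<Longrightarrow> i < n \<Longrightarrow> s \<le> m i"
  shows "(\<Sum>i<n. (y (Suc i) - y i) * ramp (m i) (m (Suc i)) s)
       = y k - y 0 + (if k < n then (y (Suc k) - y k) * ramp (m k) (m (Suc k)) s else 0)"
proof -
  let ?g = "\<lambda>i. (y (Suc i) - y i) * ramp (m i) (m (Suc i)) s"
  have "(\<Sum>i<k. ?g i) = (\<Sum>i<k. y (Suc i) - y i)"
    using m k by (intro sum.cong) (auto simp: ramp_right)
  then have left: "(\<Sum>i<k. ?g i) = y k - y 0" by (simp add: sum_lessThan_telescope)
  show ?thesis
  proof (cases "k < n")
    case True
    have "(\<Sum>i<n. ?g i) = (\<Sum>i<Suc k. ?g i)"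
      using True m right by (intro sum.mono_neutral_right) (auto simp: ramp_left)
    then show ?thesis using left True by simp
  qed (use k left in simp)
qed

section \<open>The path of the process for a good sample\<close>

context
  fixes u :: "nat \<Rightarrow> real" and n :: nat
  assumes n: "n \<ge> 1"
    and inj: "inj_on u {1..n}"
    and range01: "\<And>i. i \<in> {1..n} \<Longrightarrow> 0 < u i \<and> u i < 1"
begin

lemma order_mid_0: "order_mid u n 0 = order_stat u n 1 / 2"
  by (simp add: order_mid_def order_stat_def)

lemma order_mid_n: "order_mid u n n = (order_stat u n n + 1) / 2"
  by (simp add: order_mid_def order_stat_def[of _ _ "Suc n"])

text \<open>
  The continuous distribution function interpolates linearly the values of the empirical one:
  the knots are the midpoints of neighbouring order statistics.
\<close>

lemma cont_emp_cdf_hinges: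
  "cont_emp_cdf u n s
     = (\<Sum>i<n. (emp_cdf u n (order_stat u n (Suc i)) - emp_cdf u n (order_stat u n i))
               * ramp (order_mid u n i) (order_mid u n (Suc i)) s)"
proof -
  let ?m = "order_mid u n" and ?y = "\<lambda>i. emp_cdf u n (order_stat u n i)"
  note less = order_mid_less_Suc[OF n inj range01]
  note mono = order_mid_mono[OF n inj range01]
  have y0: "?y 0 = 0" using emp_cdf_0[OF n inj range01] by (simp add: order_stat_def)
  consider "s \<le> ?m 0" | "?m n \<le> s" | "?m 0 < s" "s < ?m n" by linarith
  then show ?thesis
  proof cases
    case 1
    have "s \<le> ?m i" if "i < n" for i using mono[of 0 i] that 1 by simp
    then have "(\<Sum>i<n. (?y (Suc i) - ?y i) * ramp (?m i) (?m (Suc i)) s) = 0"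
      using less by (intro sum.neutral) (auto simp: ramp_left)
    then show ?thesis using cont_emp_cdf_left[OF n inj range01, of s] 1 by (simp add: order_mid_0)
  next
    case 2
    have "?m (Suc i) \<le> s" if "i < n" for i using mono[of "Suc i" n] that 2 by simp
    then show ?thesis
      using sum_ramps[of n ?m n s ?y] less y0 emp_cdf_last[OF n inj range01]
        cont_emp_cdf_right[OF n inj range01, of s] 2 by (simp add: order_mid_n)
  next
    case 3
    define k where "k = (GREATEST k. k \<le> n \<and> ?m k \<le> s)"
    have k: "k \<le> n \<and> ?m k \<le> s"
      unfolding k_def by (rule GreatestI_nat[of _ 0 n]) (use 3 in auto)
    have kn: "k < n" using k 3 by (metis le_neq_implies_less not_less)
    have gt: "s \<le> ?m (Suc k)"
    proof (rule ccontr)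
      assume "\<not> s \<le> ?m (Suc k)"
      then have "Suc k \<le> (GREATEST k. k \<le> n \<and> ?m k \<le> s)"
        using kn by (intro Greatest_le_nat[of _ _ n]) auto
      then have "Suc k \<le> k" by (simp only: k_def)
      then show False by simp
    qed
    have "?m (Suc i) \<le> s" if "i < k" for i using mono[of "Suc i" k] that k by simp
    moreover have "s \<le> ?m i" if "Suc k \<le> i" "i < n" for i using mono[of "Suc k" i] that gt by simp
    ultimately have "(\<Sum>i<n. (?y (Suc i) - ?y i) * ramp (?m i) (?m (Suc i)) s)
        = ?y k + (?y (Suc k) - ?y k) * ramp (?m k) (?m (Suc k)) s"
      using sum_ramps[of n ?m k s ?y] less kn y0 by simp
    also have "\<dots> = cont_piece u n k s"
    proof -
      have "?m (Suc k) - ?m k = (order_stat u n (k + 2) - order_stat u n k) / 2"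
        by (simp add: order_mid_def field_simps)
      then have "ramp (?m k) (?m (Suc k)) s
          = (s - ?m k) / ((order_stat u n (k + 2) - order_stat u n k) / 2)"
        using ramp_mid[OF less[OF _ kn], of s] k gt by (simp only:)
      moreover have "a * (p / (q / 2)) = 2 * p * (a / q)" for a p q :: real by simp
      ultimately show ?thesis by (simp only: cont_piece_def order_mid_def Suc_eq_plus1)
    qed
    finally show ?thesis using cont_emp_cdf_piece[OF n inj range01 kn, of s] k gt by simp
  qed
qed

lemma bdd_level_energy_cont_emp_process: "bdd_above (range (level_energy (cont_emp_process u n)))"
proof -
  have ramp: "ramp a b = (\<lambda>s. (1 / (b - a)) * (hinge a s + (- 1) * hinge b s))" for a b
    by (auto simp: ramp_def)
  have "cont_emp_process u n = (\<lambda>s. sqrt (real n) * (cont_emp_cdf u n s + ((- 1) * s + 0)))"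
    by (auto simp: cont_emp_process_def)
  then show ?thesis
    unfolding cont_emp_cdf_hinges ramp
    by (simp only:) (intro bdd_level_energy_cmult bdd_level_energy_add bdd_level_energy_sum
        bdd_level_energy_hinge bdd_level_energy_affine)
qed

lemma level_energy_cont_emp_process_not_tendsto_0:
  assumes irr: "\<And>i. i \<in> {1..n} \<Longrightarrow> u i \<notin> \<rat>"
  shows "\<not> level_energy (cont_emp_process u n) \<longlonglongrightarrow> 0"
proof -
  let ?m = "order_mid u n" and ?y = "\<lambda>i. emp_cdf u n (order_stat u n i)"
  note less = order_mid_less_Suc[OF n inj range01]
  note mono = order_mid_mono[OF n inj range01]
  obtain i where i: "i \<in> {1..n}" "order_stat u n 1 = u i"
    using order_stat_mem[OF n inj range01, of 1] n by auto
  have m0: "?m 0 = u i / 2" using order_mid_0 i by simp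
  have pos: "0 < ?m 0" using m0 range01[OF i(1)] by simp
  have "order_stat u n n < 1"
    using order_stat_mem[OF n inj range01, of n] n range01 by auto
  then have le1: "?m 1 \<le> 1" using mono[of 1 n] n order_mid_n by simp
  have y0: "?y 0 = 0" using emp_cdf_0[OF n inj range01] by (simp add: order_stat_def)
  have "(1::real) \<le> (\<Sum>l = 1..n. indicator {..u i} (u l))"
    using member_le_sum[of i "{1..n}" "\<lambda>l. indicator {..u i} (u l) :: real"] i by simp
  then have y1: "0 < ?y 1" using i n by (simp add: emp_cdf_def)
  \<comment> \<open>The slope changes at the first midpoint by \<open>c\<close>, from \<open>- sqrt n\<close>.\<close>
  define c where "c = sqrt (real n) * ?y 1 / (?m 1 - ?m 0)"
  have c: "c \<noteq> 0" using y1 n less[of 0] by (simp add: c_def)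
  have nd: "2 ^ j * ?m 0 \<notin> \<int>" for j
  proof
    assume "2 ^ j * ?m 0 \<in> \<int>"
    then have "2 ^ j * ?m 0 \<in> \<rat>" using Ints_subset_Rats by blast
    then have "(2 / 2 ^ j) * (2 ^ j * ?m 0) \<in> \<rat>"
      by (intro Rats_mult[of "2 / 2 ^ j"] Rats_divide Rats_power Rats_number_of)
    moreover have "(2 / 2 ^ j) * (2 ^ j * ?m 0) = u i" by (simp add: m0)
    ultimately show False using irr[OF i(1)] by metis
  qed
  have "cont_emp_process u n s = c * hinge (?m 0) s + ((- sqrt (real n)) * s + 0)"
    if "s \<le> ?m 1" for s
  proof -
    have "s \<le> ?m l" if "Suc 0 \<le> l" "l < n" for l
      using mono[of "Suc 0" l] that \<open>s \<le> ?m 1\<close> by simp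
    then have "cont_emp_cdf u n s = ?y 1 * ramp (?m 0) (?m 1) s"
      using sum_ramps[of n ?m 0 s ?y] less n y0 by (simp add: cont_emp_cdf_hinges)
    also have "ramp (?m 0) (?m 1) s = hinge (?m 0) s / (?m 1 - ?m 0)"
      using that by (simp add: ramp_def)
    finally show ?thesis by (simp add: cont_emp_process_def c_def algebra_simps)
  qed
  then show ?thesis
    using less[of 0] n pos le1 c nd by (intro level_energy_not_tendsto_0[of "?m 0" "?m 1" c _ "- sqrt (real n)" 0]) auto
qed

lemma schauder_coeffs_cont_emp_process:
  assumes "\<And>i. i \<in> {1..n} \<Longrightarrow> u i \<notin> \<rat>"
  shows "schauder_coeffs (cont_emp_process u n) \<in> S_space 2 (1 / 2)"
    and "schauder_coeffs (cont_emp_process u n) \<notin> S_space0 2 (1 / 2)"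
proof -
  show "schauder_coeffs (cont_emp_process u n) \<in> S_space 2 (1 / 2)"
    by (rule schauder_coeffs_in_S_spaceI[OF bdd_level_energy_cont_emp_process])
  show "schauder_coeffs (cont_emp_process u n) \<notin> S_space0 2 (1 / 2)"
  proof
    assume "schauder_coeffs (cont_emp_process u n) \<in> S_space0 2 (1 / 2)"
    then have "(\<lambda>j. sqrt (level_energy (cont_emp_process u n) j)) \<longlonglongrightarrow> 0"
      by (simp add: S_space0_def level_norm_schauder_coeffs[abs_def])
    then have "(\<lambda>j. (sqrt (level_energy (cont_emp_process u n) j))\<^sup>2) \<longlonglongrightarrow> 0\<^sup>2"
      by (rule tendsto_power)
    then show False
      using level_energy_cont_emp_process_not_tendsto_0[OF assms] by (simp add: level_energy_nonneg)
  qed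
qed

end

section \<open>Almost every sample is good\<close>

text \<open>The joint law is a product measure, so by Fubini the diagonal is null if every vertical section is.\<close>

lemma (in prob_space) AE_indep_var_neq:
  fixes X Y :: "'a \<Rightarrow> real"
  assumes ind: "indep_var borel X borel Y"
    and atomless: "\<And>y. emeasure (distr M borel Y) {y} = 0"
  shows "AE \<omega> in M. X \<omega> \<noteq> Y \<omega>"
proof -
  have X: "random_variable borel X" and Y: "random_variable borel Y"
    and D: "distr M borel X \<Otimes>\<^sub>M distr M borel Y = distr M (borel \<Otimes>\<^sub>M borel) (\<lambda>x. (X x, Y x))"
    using ind by (simp_all add: indep_var_distribution_eq)
  interpret X: prob_space "distr M borel X" by (rule prob_space_distr[OF X])
  interpret Y: prob_space "distr M borel Y" by (rule prob_space_distr[OF Y])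
  interpret P: pair_sigma_finite "distr M borel X" "distr M borel Y" ..
  have meas: "{z \<in> space (borel \<Otimes>\<^sub>M borel). fst z \<noteq> (snd z :: real)} \<in> sets (borel \<Otimes>\<^sub>M borel)"
    by measurable
  have "AE x in distr M borel X. AE y in distr M borel Y. x \<noteq> y"
  proof (rule AE_I2)
    fix x
    show "AE y in distr M borel Y. x \<noteq> y"
      by (rule AE_I[where N = "{x}"]) (use atomless in auto)
  qed
  then have "AE z in distr M borel X \<Otimes>\<^sub>M distr M borel Y. fst z \<noteq> snd z"
    using meas by (intro P.AE_pair_measure) (auto simp: space_pair_measure cong: sets_pair_measure_cong)
  then show ?thesis
    unfolding D using X Y meas by (subst (asm) AE_distr_iff) auto
qed

theorem theorem2p1:
  fixes M :: "'a measure" and U :: "nat \<Rightarrow> 'a \<Rightarrow> real"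
  assumes "prob_space M"
    and "prob_space.indep_vars M (\<lambda>_. borel) U {1..}"
    and "\<And>i. i \<ge> 1 \<Longrightarrow> distr M borel (U i) = uniform_measure lborel {0<..<1}"
  shows "\<forall>n\<ge>1. AE \<omega> in M.
           schauder_coeffs (cont_emp_process (\<lambda>i. U i \<omega>) n) \<in> S_space 2 (1 / 2)
         \<and> schauder_coeffs (cont_emp_process (\<lambda>i. U i \<omega>) n) \<notin> S_space0 2 (1 / 2)"
proof (intro allI impI)
  fix n :: nat
  assume n: "n \<ge> 1"
  interpret prob_space M by fact
  have meas: "U i \<in> borel_measurable M" if "i \<ge> 1" for i
    using assms(2) that by (auto simp: indep_vars_def)
  have good: "AE \<omega> in M. 0 < U i \<omega> \<and> U i \<omega> < 1 \<and> U i \<omega> \<notin> \<rat>" if "i \<ge> 1" for i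
  proof -
    have "AE x in lborel. x \<notin> (\<rat> :: real set)"
      by (rule AE_not_in) (simp add: countable_imp_null_set_lborel countable_rat)
    then have "AE x in uniform_measure lborel {0<..<1::real}. 0 < x \<and> x < 1 \<and> x \<notin> \<rat>"
      by (intro AE_uniform_measureI) auto
    then have "AE x in distr M borel (U i). 0 < x \<and> x < 1 \<and> x \<notin> \<rat>"
      unfolding assms(3)[OF that] .
    then show ?thesis
      by (rule AE_distrD[OF meas[OF that]])
  qed
  have distinct: "AE \<omega> in M. i \<noteq> l \<longrightarrow> U i \<omega> \<noteq> U l \<omega>" if "i \<ge> 1" "l \<ge> 1" for i l
  proof (cases "i = l")
    case False
    \<comment> \<open>Independence of \<open>U i\<close> from a sum of other variables, applied to the sum with the one term \<open>U l\<close>.\<close>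
    have "indep_var borel (U i) borel (\<lambda>\<omega>. \<Sum>l\<in>{l}. U l \<omega>)"
      by (rule indep_vars_sum) (use False that indep_vars_subset[OF assms(2)] in auto)
    then have "indep_var borel (U i) borel (U l)" by simp
    then have "AE \<omega> in M. U i \<omega> \<noteq> U l \<omega>"
    proof (rule AE_indep_var_neq)
      show "emeasure (distr M borel (U l)) {y} = 0" for y
      proof -
        have "emeasure lborel ({0<..<1} \<inter> {y}) \<le> emeasure lborel {y}"
          by (rule emeasure_mono) auto
        then show ?thesis using assms(3)[OF that(2)] by simp
      qed
    qed
    then show ?thesis by auto
  qed simp
  have "AE \<omega> in M. \<forall>i\<in>{1..n}. (0 < U i \<omega> \<and> U i \<omega> < 1 \<and> U i \<omega> \<notin> \<rat>)
      \<and> (\<forall>l\<in>{1..n}. i \<noteq> l \<longrightarrow> U i \<omega> \<noteq> U l \<omega>)"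
    using good distinct by (intro AE_finite_allI AE_conjI) auto
  then show "AE \<omega> in M. schauder_coeffs (cont_emp_process (\<lambda>i. U i \<omega>) n) \<in> S_space 2 (1 / 2)
         \<and> schauder_coeffs (cont_emp_process (\<lambda>i. U i \<omega>) n) \<notin> S_space0 2 (1 / 2)"
  proof eventually_elim
    case (elim \<omega>)
    have "inj_on (\<lambda>i. U i \<omega>) {1..n}" using elim by (auto simp: inj_on_def)
    then show ?case
      using schauder_coeffs_cont_emp_process[OF n, of "\<lambda>i. U i \<omega>"] elim by blast
  qed
qed

end
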